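(* Let $A \in \mathbb{C}^{n\times n}$ be Hermitian and let $(\lambda_1, \boldsymbol{v}_1)$ be an eigenpair of $A$ with $\|\boldsymbol{v}_1\|=1$ and $\lambda_1$ a simple eigenvalue. Consider the Projected Rayleigh Quotient Iteration (PRQI) for $A$ with residuals $\boldsymbol{r}^{(k)} = (A - \mu^{(k)} I)\boldsymbol{x}^{(k)}$. (i) If $\gamma^{(k)} = \|\boldsymbol{r}^{(k)}\|$ for all $k \ge 0$, then PRQI converges locally quadratically to $\boldsymbol{v}_1$. (ii) If $\gamma^{(k)} = \|\boldsymbol{r}^{(k)}\|^2$ for all $k \ge 0$, then PRQI converges locally cubically to $\boldsymbol{v}_1$. Here, local convergence of order $p$ ($p=2$: quadratic, $p=3$: cubic) means: there exist constants $\varepsilon > 0$ and $K > 0$ such that for every unit vector $\boldsymbol{x}^{(0)} \in \mathbb{C}^n$ that is not an eigenvector of $A$ and satisfies $\tan(\theta(\boldsymbol{x}^{(0)}, \boldsymbol{v}_1)) \le \varepsilon$, the PRQI iterates satisfy $$\tan\big(\theta(\boldsymbol{x}^{(k+1)}, \boldsymbol{v}_1)\big) \le K \tan^{p}\big(\theta(\boldsymbol{x}^{(k)}, \boldsymbol{v}_1)\big) \quad\text{for all } k \ge 0, \qquad\text{and}\qquad \tan\big(\theta(\boldsymbol{x}^{(k)}, \boldsymbol{v}_1)\big) \to 0 \text{ as } k \to \infty.$$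
   Context: $\|\cdot\|$ is the Euclidean norm on $\mathbb{C}^n$; $\ast$ denotes conjugate transpose; $i$ is the imaginary unit. For nonzero $\boldsymbol{u}, \boldsymbol{w} \in \mathbb{C}^n$ the angle is $$\theta(\boldsymbol{u},\boldsymbol{w}) = \arccos\left(\frac{|\boldsymbol{u}^\ast \boldsymbol{w}|}{\|\boldsymbol{u}\|\,\|\boldsymbol{w}\|}\right) \in [0,\pi/2],$$ with the convention $\tan(\pi/2) = +\infty$. Projected Rayleigh Quotient Iteration (PRQI): given $\boldsymbol{x}^{(0)}$ with $\|\boldsymbol{x}^{(0)}\|=1$, for $k = 0,1,2,\dots$ set $\mu^{(k)} = (\boldsymbol{x}^{(k)})^\ast A \boldsymbol{x}^{(k)} \in \mathbb{R}$, choose a real scaling factor $\gamma^{(k)} > 0$ (which may depend on the iterates $\boldsymbol{x}^{(0)},\dots,\boldsymbol{x}^{(k)}$), solve $$\big[A - (\mu^{(k)} - i\gamma^{(k)}) I\big]\boldsymbol{z}^{(k+1)} = \boldsymbol{x}^{(k)}$$ for $\boldsymbol{z}^{(k+1)}$, and set $\boldsymbol{x}^{(k+1)} = \boldsymbol{z}^{(k+1)}/\|\boldsymbol{z}^{(k+1)}\|$. The residual $\boldsymbol{r}^{(k)}$ vanishes exactly when $\boldsymbol{x}^{(k)}$ is an eigenvector of $A$; in that case the iteration stops. If $\boldsymbol{x}^{(0)}$ is not an eigenvector of $A$, then no iterate is. *)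

theory Defs
  imports "HOL-Analysis.Analysis" "HOL-Computational_Algebra.Polynomial"
begin

text \<open>
  Vectors are of type \<open>complex ^ 'n\<close> (whose \<open>norm\<close> is the Euclidean norm) and matrices of type
  \<open>complex ^ 'n ^ 'n\<close>. The library inner product on \<open>complex ^ 'n\<close> is the real one, so the
  sesquilinear form \<open>u\<^sup>* w\<close> is defined here, conjugate-linear in its first argument.
\<close>

definition cdot :: "complex ^ 'n \<Rightarrow> complex ^ 'n \<Rightarrow> complex" where
  "cdot u w = (\<Sum>i\<in>UNIV. cnj (u $ i) * w $ i)"

definition conj_transpose :: "complex ^ 'n ^ 'm \<Rightarrow> complex ^ 'm ^ 'n" where
  "conj_transpose A = (\<chi> i j. cnj (A $ j $ i))"

definition hermitian :: "complex ^ 'n ^ 'n \<Rightarrow> bool" where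
  "hermitian A \<longleftrightarrow> conj_transpose A = A"

definition eigenpair :: "complex ^ 'n ^ 'n \<Rightarrow> complex \<Rightarrow> complex ^ 'n \<Rightarrow> bool" where
  "eigenpair A l v \<longleftrightarrow> v \<noteq> 0 \<and> A *v v = l *s v"

definition eigenvector :: "complex ^ 'n ^ 'n \<Rightarrow> complex ^ 'n \<Rightarrow> bool" where
  "eigenvector A v \<longleftrightarrow> (\<exists>l. eigenpair A l v)"

definition charpoly :: "complex ^ 'n ^ 'n \<Rightarrow> complex poly" where
  "charpoly A = det (mat [:0, 1:] - map_matrix (\<lambda>a. [:a:]) A)"

text \<open>Simple means algebraic multiplicity one.\<close>

definition simple_eigenvalue :: "complex ^ 'n ^ 'n \<Rightarrow> complex \<Rightarrow> bool" where
  "simple_eigenvalue A l \<longleftrightarrow> order l (charpoly A) = 1"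

definition angle :: "complex ^ 'n \<Rightarrow> complex ^ 'n \<Rightarrow> real" where
  "angle u w = arccos (cmod (cdot u w) / (norm u * norm w))"

text \<open>
  In HOL, \<open>tan (pi / 2) = 0\<close>; the convention \<open>tan (pi / 2) = \<infinity>\<close> needs extended reals.
\<close>

definition tan_ext :: "real \<Rightarrow> ereal" where
  "tan_ext t = (if t = pi / 2 then \<infinity> else ereal (tan t))"

text \<open>Complex-valued as a term; real if \<open>A\<close> is Hermitian (\<open>rayleigh_real\<close> below).\<close>

definition rayleigh :: "complex ^ 'n ^ 'n \<Rightarrow> complex ^ 'n \<Rightarrow> complex" where
  "rayleigh A x = cdot x (A *v x)"

definition residual :: "complex ^ 'n ^ 'n \<Rightarrow> complex ^ 'n \<Rightarrow> complex ^ 'n" where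
  "residual A x = (A - mat (rayleigh A x)) *v x"

definition prqi_matrix :: "complex ^ 'n ^ 'n \<Rightarrow> real \<Rightarrow> complex ^ 'n \<Rightarrow> complex ^ 'n ^ 'n" where
  "prqi_matrix A g x = A - mat (rayleigh A x - \<i> * of_real g)"

text \<open>
  \<open>prqi A \<gamma> x\<close>: the sequence \<open>x\<close> is produced by PRQI with scaling factors \<open>\<gamma>\<close>. Since \<open>\<gamma>\<close> is an
  arbitrary sequence, \<open>\<gamma> k\<close> may depend on all iterates so far. The iteration stops at a vanishing
  residual: the next entry of the sequence is then unconstrained.
\<close>

definition prqi ::
  "complex ^ 'n ^ 'n \<Rightarrow> (nat \<Rightarrow> real) \<Rightarrow> (nat \<Rightarrow> complex ^ 'n) \<Rightarrow> bool" where
  "prqi A \<gamma> x \<longleftrightarrow>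
     norm (x 0) = 1 \<and>
     (\<forall>k. residual A (x k) \<noteq> 0 \<longrightarrow>
        \<gamma> k > 0 \<and>
        (\<exists>z. prqi_matrix A (\<gamma> k) (x k) *v z = x k \<and> x (Suc k) = z /\<^sub>R norm z))"

text \<open>
  Local convergence of order \<open>p\<close> to \<open>v\<close> of PRQI with the scaling factors \<open>\<gamma> k = g (x k)\<close>.
  For Hermitian \<open>A\<close> the quantification over \<open>x\<close> is not vacuous: by \<open>prqi_exists\<close> below, every unit
  vector starts such a sequence, and the linear system has exactly one solution.
\<close>

definition prqi_locally_convergent ::
  "complex ^ 'n ^ 'n \<Rightarrow> (complex ^ 'n \<Rightarrow> real) \<Rightarrow> nat \<Rightarrow> complex ^ 'n \<Rightarrow> bool" where
  "prqi_locally_convergent A g p v \<longleftrightarrow>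
     (\<exists>\<epsilon>>0. \<exists>K>0. \<forall>\<gamma> x.
        prqi A \<gamma> x \<longrightarrow> (\<forall>k. \<gamma> k = g (x k)) \<longrightarrow>
        \<not> eigenvector A (x 0) \<longrightarrow> tan_ext (angle (x 0) v) \<le> ereal \<epsilon> \<longrightarrow>
        (\<forall>k. tan_ext (angle (x (Suc k)) v) \<le> ereal K * tan_ext (angle (x k) v) ^ p) \<and>
        (\<lambda>k. tan_ext (angle (x k) v)) \<longlonglongrightarrow> 0)"

lemma cdot_self: "cdot z z = of_real ((norm z)\<^sup>2)"
proof -
  have "(norm z)\<^sup>2 = (\<Sum>i\<in>UNIV. (cmod (z $ i))\<^sup>2)"
    by (simp add: norm_vec_def L2_set_def sum_nonneg)
  then show ?thesis
    by (simp add: cdot_def complex_norm_square mult.commute del: of_real_power)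
qed

lemma rayleigh_real:
  assumes "hermitian A"
  shows "rayleigh A x \<in> \<real>"
proof -
  have h: "cnj (A $ i $ j) = A $ j $ i" for i j
    using assms by (metis (no_types, lifting) conj_transpose_def hermitian_def vec_lambda_beta)
  have "cnj (rayleigh A x) = (\<Sum>i\<in>UNIV. \<Sum>j\<in>UNIV. x $ i * (A $ j $ i * cnj (x $ j)))"
    by (simp add: rayleigh_def cdot_def matrix_vector_mult_def sum_distrib_left h)
  also have "\<dots> = (\<Sum>j\<in>UNIV. \<Sum>i\<in>UNIV. x $ i * (A $ j $ i * cnj (x $ j)))"
    by (rule sum.swap)
  also have "\<dots> = rayleigh A x"
    by (simp add: rayleigh_def cdot_def matrix_vector_mult_def sum_distrib_left mult_ac)
  finally show ?thesis by (simp add: Reals_cnj_iff)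
qed

lemma mat_mult_vec: "mat c *v (z :: complex ^ 'n) = c *s z"
  by (simp add: vec_eq_iff matrix_vector_mult_def mat_def if_distrib if_distribR cong: if_cong)

lemma prqi_matrix_unique_solution:
  fixes A :: "complex ^ 'n ^ 'n"
  assumes A: "hermitian A" and g: "g > 0"
  shows "\<exists>!z. prqi_matrix A g x *v z = b"
proof -
  let ?M = "prqi_matrix A g x"
  have ker: "z = 0" if "?M *v z = 0" for z
  proof -
    have "A *v z = (rayleigh A x - \<i> * of_real g) *s z"
      using that by (simp add: prqi_matrix_def matrix_vector_mult_diff_rdistrib mat_mult_vec)
    moreover have "cdot z (c *s z) = c * cdot z z" for c
      by (simp add: cdot_def sum_distrib_left mult_ac)
    ultimately have "rayleigh A z = (rayleigh A x - \<i> * of_real g) * of_real ((norm z)\<^sup>2)"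
      by (simp only: rayleigh_def [of A z] cdot_self)
    then have "Im (rayleigh A z) =
        Im ((rayleigh A x - \<i> * of_real g) * of_real ((norm z)\<^sup>2))"
      by simp
    moreover have "Im (rayleigh A y) = 0" for y
      using rayleigh_real [OF A] by (simp add: complex_is_Real_iff)
    ultimately have "g * (norm z)\<^sup>2 = 0"
      by (simp del: of_real_power)
    with g show ?thesis by simp
  qed
  then have "invertible ?M"
    by (simp add: invertible_left_inverse matrix_left_invertible_ker)
  then obtain B where "?M ** B = mat 1" "B ** ?M = mat 1"
    by (auto simp: invertible_def)
  then show ?thesis
    by (metis matrix_vector_mul_assoc matrix_vector_mul_lid)
qed

lemma prqi_exists:
  fixes A :: "complex ^ 'n ^ 'n"
  assumes A: "hermitian A" and "norm x0 = 1"
    and g: "\<And>y. residual A y \<noteq> 0 \<Longrightarrow> g y > 0"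
  shows "\<exists>x. x 0 = x0 \<and> prqi A (\<lambda>k. g (x k)) x"
proof -
  define s where "s y = (SOME z. prqi_matrix A (g y) y *v z = y)" for y
  define x where "x = rec_nat x0 (\<lambda>_ y. s y /\<^sub>R norm (s y))"
  have "prqi_matrix A (g y) y *v s y = y" if "residual A y \<noteq> 0" for y
    unfolding s_def
    by (rule someI_ex) (use prqi_matrix_unique_solution [OF A g [OF that]] in blast)
  moreover have "x 0 = x0" "x (Suc k) = s (x k) /\<^sub>R norm (s (x k))" for k
    by (simp_all add: x_def)
  ultimately show ?thesis
    using assms unfolding prqi_def by blast
qed

end

theory Submission
  imports Defs
begin

text \<open>
  Write \<open>x = c v\<^sub>1 + w\<close> with \<open>w\<close> orthogonal to \<open>v\<^sub>1\<close>, so that \<open>tan \<theta>(x, v\<^sub>1) = \<parallel>w\<parallel> / \<bar>c\<bar>\<close>. One step solves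
  \<open>(A - \<lambda>\<^sub>1 + \<sigma>) z = x\<close> with \<open>\<sigma> = \<lambda>\<^sub>1 - \<mu> + i \<gamma>\<close>: the component along \<open>v\<^sub>1\<close> is divided by \<open>\<sigma>\<close>, whereas on the
  orthogonal complement \<open>A - \<lambda>\<^sub>1\<close> is bounded below by some \<open>\<delta> > 0\<close>, by simplicity of \<open>\<lambda>\<^sub>1\<close>. Hence the tangent
  is multiplied by at most \<open>2 \<bar>\<sigma>\<bar> / \<delta>\<close>. As \<open>\<bar>\<mu> - \<lambda>\<^sub>1\<bar>\<close> is of order \<open>\<parallel>w\<parallel>\<^sup>2\<close> and the residual is of order \<open>\<parallel>w\<parallel>\<close>, the
  factor \<open>\<bar>\<sigma>\<bar>\<close> is of order \<open>\<parallel>w\<parallel>\<close> for \<open>\<gamma> = \<parallel>r\<parallel>\<close> and of order \<open>\<parallel>w\<parallel>\<^sup>2\<close> for \<open>\<gamma> = \<parallel>r\<parallel>\<^sup>2\<close>.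
\<close>

section \<open>The sesquilinear form and Hermitian matrices\<close>

lemma cdot_add_right: "cdot u (x + y) = cdot u x + cdot u y"
  by (simp add: cdot_def algebra_simps sum.distrib)

lemma cdot_diff_right: "cdot u (x - y) = cdot u x - cdot u y"
  by (simp add: cdot_def algebra_simps sum_subtractf)

lemma cdot_diff_left: "cdot (x - y) u = cdot x u - cdot y u"
  by (simp add: cdot_def algebra_simps sum_subtractf)

lemma cdot_scale_right: "cdot u (c *s x) = c * cdot u x"
  by (simp add: cdot_def sum_distrib_left mult_ac)

lemma cdot_scale_left: "cdot (c *s u) x = cnj c * cdot u x"
  by (simp add: cdot_def sum_distrib_left mult_ac)

lemma cdot_scaleR_right: "cdot u (r *\<^sub>R x) = of_real r * cdot u x"
  by (simp add: cdot_def sum_distrib_left scaleR_conv_of_real [where 'a = complex] mult_ac)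

lemma cdot_zero_left: "cdot 0 x = 0"
  by (simp add: cdot_def)

lemma cdot_commute: "cdot u x = cnj (cdot x u)"
  by (simp add: cdot_def mult.commute)

lemma norm_cdot_le: "cmod (cdot u x) \<le> norm u * norm x"
proof -
  have "cmod (cdot u x) \<le> (\<Sum>i\<in>UNIV. \<bar>norm (u $ i)\<bar> * \<bar>norm (x $ i)\<bar>)"
    unfolding cdot_def by (rule sum_norm_le) (simp add: norm_mult)
  also have "\<dots> \<le> norm u * norm x"
    unfolding norm_vec_def by (rule L2_set_mult_ineq)
  finally show ?thesis .
qed

lemma norm_vector_smult: "norm (c *s x) = cmod c * norm x" for x :: "complex ^ 'n"
proof -
  have "cdot (c *s x) (c *s x) = (c * cnj c) * cdot x x"
    by (simp add: cdot_scale_left cdot_scale_right mult_ac)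
  then have "complex_of_real ((norm (c *s x))\<^sup>2) = of_real ((cmod c * norm x)\<^sup>2)"
    by (simp only: cdot_self complex_norm_square [symmetric] power_mult_distrib of_real_mult)
  then have "(norm (c *s x))\<^sup>2 = (cmod c * norm x)\<^sup>2"
    using of_real_eq_iff by blast
  then show ?thesis
    by (simp add: power2_eq_iff_nonneg)
qed

lemma hermitian_cdot:
  assumes "hermitian A"
  shows "cdot u (A *v x) = cdot (A *v u) x"
proof -
  have h: "cnj (A $ i $ j) = A $ j $ i" for i j
    using assms by (metis (no_types, lifting) conj_transpose_def hermitian_def vec_lambda_beta)
  have "cdot u (A *v x) = (\<Sum>i\<in>UNIV. \<Sum>j\<in>UNIV. cnj (u $ i) * (A $ i $ j * x $ j))"
    by (simp add: cdot_def matrix_vector_mult_def sum_distrib_left)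
  also have "\<dots> = (\<Sum>j\<in>UNIV. \<Sum>i\<in>UNIV. cnj (u $ i) * (A $ i $ j * x $ j))"
    by (rule sum.swap)
  also have "\<dots> = cdot (A *v u) x"
    by (simp add: cdot_def matrix_vector_mult_def sum_distrib_left h mult_ac)
  finally show ?thesis .
qed

lemma matrix_diff_mat_mult_vec: "(A - mat c) *v x = A *v x - c *s x" for A :: "complex ^ 'n ^ 'n"
  by (simp add: matrix_vector_mult_diff_rdistrib mat_mult_vec)

lemma hermitian_eigenvalue_real:
  assumes "hermitian A" "eigenpair A l v"
  shows "l \<in> \<real>"
proof -
  have "rayleigh A v = l * of_real ((norm v)\<^sup>2)"
    using assms(2) by (simp add: rayleigh_def eigenpair_def cdot_scale_right cdot_self del: of_real_power)
  then have "l = rayleigh A v / of_real ((norm v)\<^sup>2)"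
    using assms(2) by (simp add: eigenpair_def)
  then show ?thesis
    using rayleigh_real [OF assms(1), of v] by (metis Reals_divide Reals_of_real)
qed

lemma hermitian_diff_mat:
  assumes "hermitian A" "l \<in> \<real>"
  shows "hermitian (A - mat l)"
  using assms by (auto simp: hermitian_def conj_transpose_def mat_def vec_eq_iff Reals_cnj_iff)


section \<open>Simple eigenvalues\<close>

text \<open>Evaluation at \<open>t\<close> is a ring homomorphism, so it commutes with the Leibniz
  formula.\<close>

lemma poly_det: "poly (det M) t = det (map_matrix (\<lambda>p. poly p t) M)"
  for M :: "'a :: comm_ring_1 poly ^ 'n ^ 'n"
  by (simp add: det_def map_matrix_def poly_sum poly_prod)

lemma poly_charpoly: "poly (charpoly A) t = det (mat t - A)"
  unfolding charpoly_def poly_det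
  by (rule arg_cong [where f = det]) (simp add: vec_eq_iff map_matrix_def mat_def)

text \<open>All eigenvalues are real, so \<open>\<i>\<close> is not a root. Nonvanishing lets
  divisibility by a power of a linear factor be read off from \<open>order\<close>.\<close>

lemma charpoly_nonzero_of_hermitian:
  assumes "hermitian A"
  shows "charpoly A \<noteq> 0"
proof -
  have "z = 0" if "(mat \<i> - A) *v z = 0" for z
  proof (rule ccontr)
    assume "z \<noteq> 0"
    moreover have "A *v z = \<i> *s z"
      using that by (simp add: matrix_vector_mult_diff_rdistrib mat_mult_vec)
    ultimately have "\<i> \<in> \<real>"
      using hermitian_eigenvalue_real [OF assms, of \<i> z] by (simp add: eigenpair_def)
    then show False by (simp add: complex_is_Real_iff)
  qed
  then have "invertible (mat \<i> - A)"
    by (simp add: invertible_left_inverse matrix_left_invertible_ker)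
  then have "poly (charpoly A) \<i> \<noteq> 0"
    by (simp add: poly_charpoly invertible_det_nz)
  then show ?thesis by auto
qed

text \<open>
  Replacing two columns of the identity by eigenvectors gives an invertible \<open>P\<close> for which two columns of
  \<open>(t - A) P\<close> are divisible by \<open>t - l\<close>.
\<close>

lemma square_dvd_charpoly:
  fixes A :: "complex ^ 'n ^ 'n"
  assumes v: "A *v v = l *s v" "v \<noteq> 0" and w: "A *v w = l *s w" and indep: "\<And>c. w \<noteq> c *s v"
  shows "[:- l, 1:]\<^sup>2 dvd charpoly A"
proof -
  obtain a where a: "v $ a \<noteq> 0"
    using v by (auto simp: vec_eq_iff)
  \<comment> \<open>Clearing coordinate \<open>a\<close> forces \<open>a \<noteq> b\<close> below
    and makes \<open>P *v y = 0\<close> solvable by substitution: first coordinate \<open>a\<close>,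
    then \<open>b\<close>, then the others.\<close>
  define u where "u = w - (w $ a / v $ a) *s v"
  have ua: "u $ a = 0" using a by (simp add: u_def)
  have Au: "A *v u = l *s u"
    by (simp add: u_def matrix_vector_mult_diff_distrib vector_scalar_commute v w vec_eq_iff algebra_simps)
  have "u \<noteq> 0" using indep by (simp add: u_def)
  then obtain b where b: "u $ b \<noteq> 0" by (auto simp: vec_eq_iff)
  then have ab: "a \<noteq> b" using ua by auto
  define P :: "complex ^ 'n ^ 'n" where
    "P = (\<chi> i j. if j = a then v $ i else if j = b then u $ i else if i = j then 1 else 0)"
  have Py: "(P *v y) $ i = v $ i * y $ a + u $ i * y $ b + (if i = a \<or> i = b then 0 else y $ i)" for y i
  proof -
    have "(P *v y) $ i = (\<Sum>j\<in>UNIV. (if j = a then v $ i * y $ a else 0) + (if j = b then u $ i * y $ b else 0) +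
        (if j = i then (if i = a \<or> i = b then 0 else y $ i) else 0))"
      unfolding matrix_vector_mult_def P_def using ab by (auto intro!: sum.cong)
    then show ?thesis by (simp add: sum.distrib)
  qed
  have "y = 0" if "P *v y = 0" for y
  proof -
    have z: "v $ i * y $ a + u $ i * y $ b + (if i = a \<or> i = b then 0 else y $ i) = 0" for i
      using that Py by (metis zero_index)
    have "y $ a = 0" using z [of a] a ua by simp
    moreover from this have "y $ b = 0" using z [of b] b by simp
    ultimately show ?thesis using z by (simp add: vec_eq_iff) metis
  qed
  then have "invertible P"
    by (simp add: invertible_left_inverse matrix_left_invertible_ker)
  then have detP: "det P \<noteq> 0" by (simp add: invertible_det_nz)
  \<comment> \<open>Evaluated at \<open>t\<close>, this is \<open>(mat t - A) ** P\<close> with the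
    factor \<open>t - l\<close> taken out of columns \<open>a\<close> and \<open>b\<close>.\<close>
  define Q :: "complex poly ^ 'n ^ 'n" where
    "Q = (\<chi> i j. if j = a then [:v $ i:] else if j = b then [:u $ i:]
                else [:- A $ i $ j, if i = j then 1 else 0:])"
  have "poly (charpoly A) t * det P = poly ([:- l, 1:]\<^sup>2 * det Q) t" for t
  proof -
    let ?c = "\<lambda>j. if j = a \<or> j = b then t - l else 1"
    let ?Q = "map_matrix (\<lambda>p. poly p t) Q"
    \<comment> \<open>The transpose turns columns into rows, since \<open>det_rows_mul\<close>
      extracts factors from rows.\<close>
    have "transpose ((mat t - A) ** P) = (\<chi> j. ?c j *s (transpose ?Q $ j))"
    proof -
      have "((mat t - A) ** P) $ i $ j = ((mat t - A) *v column j P) $ i" for i j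
        by (simp add: matrix_matrix_mult_def matrix_vector_mult_def column_def)
      moreover have "column a P = v" "column b P = u"
        using ab by (auto simp: column_def P_def vec_eq_iff)
      moreover have "column j P = axis j 1" if "j \<noteq> a" "j \<noteq> b" for j
        using that by (simp add: column_def P_def vec_eq_iff axis_def)
      moreover have "(mat t - A) *v v = (t - l) *s v" "(mat t - A) *v u = (t - l) *s u"
        by (simp_all add: matrix_vector_mult_diff_rdistrib mat_mult_vec v Au vec_eq_iff algebra_simps)
      moreover have "((mat t - A) *v axis j 1) $ i = (if i = j then t else 0) - A $ i $ j" for i j
        by (simp add: matrix_vector_mult_def axis_def mat_def if_distrib cong: if_cong)
      ultimately have "((mat t - A) ** P) $ i $ j = ?c j * ?Q $ i $ j" for i j
        using ab by (cases "j = a"; cases "j = b") (simp_all add: Q_def map_matrix_def left_diff_distrib)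
      then show ?thesis
        by (simp add: vec_eq_iff transpose_def)
    qed
    then have "det (transpose ((mat t - A) ** P)) = prod ?c UNIV * det (\<chi> j. transpose ?Q $ j)"
      by (simp only: det_rows_mul)
    then have "det ((mat t - A) ** P) = prod ?c UNIV * det ?Q"
      by (simp only: det_transpose vec_lambda_eta)
    also have "prod ?c UNIV = prod (\<lambda>_. t - l) {a, b}"
      by (rule prod.mono_neutral_cong_right) auto
    also have "\<dots> = (t - l)\<^sup>2"
      using ab by (simp add: power2_eq_square)
    finally show ?thesis
      by (simp add: det_mul poly_charpoly poly_det)
  qed
  then have "poly (smult (det P) (charpoly A)) = poly ([:- l, 1:]\<^sup>2 * det Q)"
    by (intro ext) (simp add: mult.commute)
  then have "smult (det P) (charpoly A) = [:- l, 1:]\<^sup>2 * det Q"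
    by (simp only: poly_eq_poly_eq_iff)
  then have "[:- l, 1:]\<^sup>2 dvd smult (det P) (charpoly A)" by simp
  then show ?thesis using detP by (simp add: dvd_smult_iff)
qed

text \<open>A nonzero kernel vector of \<open>A - mat l\<close> orthogonal to \<open>v\<close> would
  be a second independent eigenvector and make \<open>l\<close> a double root. So the map is
  injective on the orthogonal complement, and an injective linear map in finite dimension is bounded
  below.\<close>

lemma simple_eigenvalue_gap:
  assumes A: "hermitian A" and v: "eigenpair A l v" and simple: "simple_eigenvalue A l"
  shows "\<exists>\<delta>>0. \<forall>w. cdot v w = 0 \<longrightarrow> \<delta> * norm w \<le> norm ((A - mat l) *v w)"
proof -
  let ?S = "{w. cdot v w = 0}"
  have ker: "w = 0" if "cdot v w = 0" "(A - mat l) *v w = 0" for w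
  proof (rule ccontr)
    assume "w \<noteq> 0"
    have "w \<noteq> c *s v" for c
    proof
      assume w: "w = c *s v"
      then have "c * of_real ((norm v)\<^sup>2) = 0"
        using that(1) by (simp add: cdot_scale_right cdot_self del: of_real_power)
      then show False using v w \<open>w \<noteq> 0\<close> by (auto simp: eigenpair_def)
    qed
    moreover have "A *v w = l *s w"
      using that(2) by (simp add: matrix_diff_mat_mult_vec)
    ultimately have "[:- l, 1:]\<^sup>2 dvd charpoly A"
      using v by (intro square_dvd_charpoly [of A v l w]) (simp_all add: eigenpair_def)
    then have "2 \<le> order l (charpoly A)"
      using charpoly_nonzero_of_hermitian [OF A] by (simp add: order_divides)
    then show False using simple by (simp add: simple_eigenvalue_def)
  qed
  have "subspace ?S"
    by (auto simp: subspace_def cdot_add_right cdot_scaleR_right) (simp add: cdot_def)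
  then have "\<exists>\<delta>>0. \<forall>w\<in>?S. \<delta> * norm w \<le> norm ((A - mat l) *v w)"
    using ker by (intro injective_imp_isometric) (auto simp: closed_subspace)
  then show ?thesis by auto
qed


section \<open>One step of the iteration\<close>

definition perp :: "complex ^ 'n \<Rightarrow> complex ^ 'n \<Rightarrow> complex ^ 'n" where
  "perp v x = x - cdot v x *s v"

text \<open>Division by zero gives 0 for \<open>x\<close> orthogonal to \<open>v\<close>, where the
  true tangent is infinite; hence \<open>cdot v x \<noteq> 0\<close> is tracked separately
  throughout.\<close>

definition tangent :: "complex ^ 'n \<Rightarrow> complex ^ 'n \<Rightarrow> real" where
  "tangent v x = norm (perp v x) / cmod (cdot v x)"

lemma tangent_nonneg: "0 \<le> tangent v x"
  by (simp add: tangent_def)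

lemma cdot_perp:
  assumes "norm v = 1"
  shows "cdot v (perp v x) = 0"
  using assms by (simp add: perp_def cdot_diff_right cdot_scale_right cdot_self)

text \<open>Pythagoras for the splitting of \<open>x\<close> along \<open>v\<close> and its
  orthogonal complement.\<close>

lemma norm_perp:
  assumes "norm v = 1"
  shows "(norm (perp v x))\<^sup>2 = (norm x)\<^sup>2 - (cmod (cdot v x))\<^sup>2"
proof -
  have "cdot (perp v x) (perp v x) = cdot x (perp v x)"
    unfolding perp_def [of v x] cdot_diff_left cdot_scale_left
    using cdot_perp [OF assms, of x] by (simp add: perp_def)
  also have "\<dots> = cdot x x - cdot v x * cnj (cdot v x)"
    by (simp add: perp_def cdot_diff_right cdot_scale_right cdot_commute [of x v])
  finally have "complex_of_real ((norm (perp v x))\<^sup>2) = of_real ((norm x)\<^sup>2 - (cmod (cdot v x))\<^sup>2)"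
    by (simp only: cdot_self complex_norm_square [symmetric] of_real_diff)
  then show ?thesis using of_real_eq_iff by blast
qed

lemma tangent_scaleR:
  assumes "r \<noteq> 0"
  shows "tangent v (r *\<^sub>R x) = tangent v x"
proof -
  have "perp v (r *\<^sub>R x) = r *\<^sub>R perp v x"
    by (simp add: perp_def cdot_scaleR_right vec_eq_iff algebra_simps scaleR_conv_of_real [where 'a = complex])
  then show ?thesis
    using assms by (simp add: tangent_def cdot_scaleR_right norm_mult)
qed

text \<open>The cosine of the angle is \<open>cmod (cdot v x)\<close>, and by Pythagoras its sine is
  \<open>norm (perp v x)\<close>. This reduces the extended tangent to real arithmetic.\<close>

lemma tan_ext_angle:
  assumes v: "norm v = 1" and x: "norm x = 1"
  shows "tan_ext (angle x v) = (if cdot v x = 0 then \<infinity> else ereal (tangent v x))"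
proof -
  let ?c = "cmod (cdot v x)"
  have c: "0 \<le> ?c" "?c \<le> 1"
    using norm_cdot_le [of v x] v x by simp_all
  have ang: "angle x v = arccos ?c"
    using v x by (simp add: angle_def cdot_commute [of x v])
  show ?thesis
  proof (cases "cdot v x = 0")
    case True
    then show ?thesis by (simp add: ang tan_ext_def)
  next
    case False
    have "sin (arccos ?c) = sqrt (1 - ?c\<^sup>2)" using c by (intro sin_arccos) linarith+
    also have "\<dots> = norm (perp v x)"
      using norm_perp [OF v, of x] x by (auto intro: real_sqrt_unique)
    finally have sin: "sin (arccos ?c) = norm (perp v x)" .
    have cos: "cos (arccos ?c) = ?c" using c by (intro cos_arccos) linarith+
    then have "arccos ?c \<noteq> pi / 2" using False by (metis cos_pi_half norm_eq_zero)
    moreover have "tan (arccos ?c) = tangent v x"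
      by (simp add: tan_def cos sin tangent_def)
    ultimately show ?thesis using False by (simp add: ang tan_ext_def)
  qed
qed

lemma norm_perp_le_tangent:
  assumes "norm v = 1" "norm x = 1" "cdot v x \<noteq> 0"
  shows "norm (perp v x) \<le> tangent v x"
proof -
  have "cmod (cdot v x) \<le> 1" using norm_cdot_le [of v x] assms by simp
  then show ?thesis
    using assms mult_left_mono [of "cmod (cdot v x)" 1 "norm (perp v x)"]
    by (simp add: tangent_def field_simps)
qed

lemma norm_perp_le_one:
  assumes "norm v = 1" "norm x = 1"
  shows "norm (perp v x) \<le> 1"
proof -
  have "(norm (perp v x))\<^sup>2 \<le> 1\<^sup>2"
    by (simp add: norm_perp assms)
  then show ?thesis by (rule power2_le_imp_le) simp
qed

section \<open>Estimates for the Rayleigh quotient, the residual and one linear solve\<close>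

lemma shifted_matrix_perp:
  assumes "A *v v = l *s v"
  shows "(A - mat l) *v perp v x = (A - mat l) *v x"
  using assms
  by (simp add: perp_def matrix_vector_mult_diff_distrib vector_scalar_commute matrix_diff_mat_mult_vec)

text \<open>As \<open>A - mat l\<close> is self-adjoint and kills \<open>v\<close>, both arguments
  of its quadratic form at \<open>x\<close> may be replaced by \<open>perp v x\<close>; this is why
  the error is quadratic.\<close>

lemma rayleigh_eigenvalue_bound:
  assumes A: "hermitian A" and l: "l \<in> \<real>" and v: "A *v v = l *s v" and x: "norm x = 1"
    and L: "\<And>y. norm ((A - mat l) *v y) \<le> L * norm y"
  shows "cmod (rayleigh A x - l) \<le> L * (norm (perp v x))\<^sup>2"
proof -
  let ?B = "A - mat l" and ?w = "perp v x"
  have "rayleigh A x - l = cdot x (?B *v x)"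
    using x by (simp add: rayleigh_def matrix_diff_mat_mult_vec cdot_diff_right cdot_scale_right cdot_self)
  also have "\<dots> = cdot (?B *v ?w) ?w"
    using hermitian_cdot [OF hermitian_diff_mat [OF A l]] shifted_matrix_perp [OF v, of x] by metis
  finally have "cmod (rayleigh A x - l) \<le> norm (?B *v ?w) * norm ?w"
    using norm_cdot_le by simp
  also have "\<dots> \<le> L * norm ?w * norm ?w"
    by (intro mult_right_mono L) simp
  finally show ?thesis by (simp add: power2_eq_square mult.assoc)
qed

text \<open>Replacing \<open>rayleigh A x\<close> by \<open>l\<close> in the residual costs a term
  quadratic in \<open>norm (perp v x)\<close>, which is absorbed into the linear one because that
  norm is at most 1.\<close>

lemma residual_bound:
  assumes A: "hermitian A" and l: "l \<in> \<real>" and v: "A *v v = l *s v" "norm v = 1" and x: "norm x = 1"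
    and L: "0 \<le> L" "\<And>y. norm ((A - mat l) *v y) \<le> L * norm y"
  shows "norm (residual A x) \<le> 2 * L * norm (perp v x)"
proof -
  let ?w = "perp v x"
  have "residual A x = (A - mat l) *v ?w - (rayleigh A x - l) *s x"
    unfolding shifted_matrix_perp [OF v(1)]
    by (simp add: residual_def matrix_diff_mat_mult_vec mat_mult_vec vec_eq_iff algebra_simps)
  then have "norm (residual A x) \<le> norm ((A - mat l) *v ?w) + cmod (rayleigh A x - l)"
    using norm_triangle_ineq4 x by (metis mult.right_neutral norm_vector_smult)
  also have "\<dots> \<le> L * norm ?w + L * (norm ?w)\<^sup>2"
    by (intro add_mono L rayleigh_eigenvalue_bound A l v x)
  also have "\<dots> \<le> L * norm ?w + L * norm ?w"
    using norm_perp_le_one [OF v(2) x] L(1)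
    by (intro add_left_mono mult_left_mono) (simp_all add: power2_eq_square mult_left_le)
  finally show ?thesis by simp
qed

text \<open>The system decouples: along \<open>v\<close> it reads
  \<open>\<sigma> * cdot v z = cdot v x\<close>, and on the complement the shift by
  \<open>\<sigma>\<close> costs at most half of the lower bound \<open>\<delta>\<close>. The claim
  is the quotient of the two estimates.\<close>

lemma tangent_step:
  assumes A: "hermitian A" and l: "l \<in> \<real>" and v: "A *v v = l *s v" "norm v = 1"
    and \<delta>: "0 < \<delta>" "\<And>w. cdot v w = 0 \<Longrightarrow> \<delta> * norm w \<le> norm ((A - mat l) *v w)"
    and x: "cdot v x \<noteq> 0" and z: "(A - mat (l - \<sigma>)) *v z = x" and \<sigma>: "cmod \<sigma> \<le> \<delta> / 2"
  shows "cdot v z \<noteq> 0" and "tangent v z \<le> 2 / \<delta> * cmod \<sigma> * tangent v x"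
proof -
  let ?B = "A - mat l"
  have Bz: "?B *v z + \<sigma> *s z = x"
    using z by (auto simp add: matrix_diff_mat_mult_vec vec_eq_iff left_diff_distrib diff_eq_eq)
  have "cdot v (?B *v y) = 0" for y
    unfolding hermitian_cdot [OF hermitian_diff_mat [OF A l]]
    using v by (simp add: matrix_diff_mat_mult_vec cdot_zero_left)
  then have cz: "\<sigma> * cdot v z = cdot v x"
    by (simp add: Bz [symmetric] cdot_add_right cdot_scale_right)
  then show nz: "cdot v z \<noteq> 0" using x by auto
  have "\<sigma> \<noteq> 0" using cz x by auto
  have "perp v x = (?B *v z + \<sigma> *s z) - (\<sigma> * cdot v z) *s v"
    by (simp only: perp_def Bz cz)
  also have "\<dots> = ?B *v perp v z + \<sigma> *s perp v z"
    unfolding shifted_matrix_perp [OF v(1)] by (simp add: perp_def vec_eq_iff right_diff_distrib)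
  finally have "perp v x = ?B *v perp v z + \<sigma> *s perp v z" .
  then have "norm (?B *v perp v z) - norm (\<sigma> *s perp v z) \<le> norm (perp v x)"
    by (simp add: norm_diff_ineq)
  moreover have "\<delta> * norm (perp v z) \<le> norm (?B *v perp v z)"
    by (intro \<delta> cdot_perp v)
  moreover have "norm (\<sigma> *s perp v z) \<le> \<delta> / 2 * norm (perp v z)"
    unfolding norm_vector_smult using \<sigma> by (intro mult_right_mono) auto
  ultimately have "norm (perp v z) \<le> 2 / \<delta> * norm (perp v x)"
    using \<delta>(1) by (simp add: field_simps)
  then have "norm (perp v z) / cmod (cdot v z) \<le> 2 / \<delta> * norm (perp v x) / cmod (cdot v z)"
    by (intro divide_right_mono) auto
  also have "\<dots> = 2 / \<delta> * cmod \<sigma> * tangent v x"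
    using \<open>\<sigma> \<noteq> 0\<close> nz by (simp add: tangent_def cz [symmetric] norm_mult)
  finally show "tangent v z \<le> 2 / \<delta> * cmod \<sigma> * tangent v x"
    by (simp add: tangent_def)
qed

section \<open>Non-eigenvectors stay non-eigenvectors\<close>

lemma residual_zero_imp_eigenvector:
  assumes "residual A x = 0" "x \<noteq> 0"
  shows "eigenvector A x"
  using assms by (auto simp: eigenvector_def eigenpair_def residual_def matrix_diff_mat_mult_vec)

lemma eigenvector_scaleR:
  assumes "eigenvector A (r *\<^sub>R x)"
  shows "eigenvector A x"
proof -
  have "r *\<^sub>R x = of_real r *s x" by (simp add: vec_eq_iff scaleR_conv_of_real[symmetric])
  with assms obtain m where m: "of_real r *s x \<noteq> 0" "A *v (of_real r *s x) = m *s (of_real r *s x)"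
    by (auto simp: eigenvector_def eigenpair_def)
  then have "complex_of_real r *s (A *v x) = of_real r *s (m *s x)"
    by (simp add: vector_scalar_commute vec_eq_iff mult_ac)
  then have "A *v x = m *s x"
    using m(1) by (auto simp: vec_eq_iff)
  then show ?thesis
    using m by (auto simp: eigenvector_def eigenpair_def)
qed

text \<open>The right-hand side is a multiple of the eigenvector \<open>z\<close>. Read
  contrapositively, solving the system from a non-eigenvector never yields an eigenvector, so the
  iteration does not stop.\<close>

lemma eigenvector_of_shifted_solution:
  assumes z: "eigenvector A z" and x: "(A - mat c) *v z = x" "x \<noteq> 0"
  shows "eigenvector A x"
proof -
  obtain m where m: "A *v z = m *s z" using z by (auto simp: eigenvector_def eigenpair_def)
  then have xz: "x = (m - c) *s z"
    using x by (auto simp add: matrix_diff_mat_mult_vec vec_eq_iff left_diff_distrib)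
  have "A *v x = m *s x"
    unfolding xz vector_scalar_commute m by (simp only: vector_smult_assoc mult.commute)
  then show ?thesis using x by (auto simp: eigenvector_def eigenpair_def)
qed


section \<open>Local convergence\<close>

text \<open>Covers both scalings at once: a shift of order \<open>q\<close> in
  \<open>norm (perp v x)\<close> gives convergence of order \<open>q + 1\<close>. The cap
  \<open>q \<le> 2\<close> reflects the quadratic error of the Rayleigh quotient.\<close>

lemma prqi_locally_convergentI:
  assumes A: "hermitian A" and l: "l \<in> \<real>" and v: "A *v v = l *s v" "norm v = 1"
    and \<delta>: "0 < \<delta>" "\<And>w. cdot v w = 0 \<Longrightarrow> \<delta> * norm w \<le> norm ((A - mat l) *v w)"
    and L: "0 < L" "\<And>y. norm ((A - mat l) *v y) \<le> L * norm y"
    and q: "1 \<le> q" "q \<le> 2"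
    and C: "0 \<le> C" "\<And>x. norm x = 1 \<Longrightarrow> g x \<le> C * norm (perp v x) ^ q"
  shows "prqi_locally_convergent A g (Suc q) v"
proof -
  \<comment> \<open>\<open>M\<close> will bound \<open>cmod \<sigma>\<close> by
    \<open>M * tangent v x ^ q\<close>, and \<open>K\<close> adds the factor
    \<open>2 / \<delta>\<close> of \<open>tangent_step\<close>. The choice of \<epsilon> gives
    \<open>cmod \<sigma> \<le> \<delta> / 4\<close>, so each step at least halves the
    tangent.\<close>
  define M where "M = L + C"
  define K where "K = 2 / \<delta> * M"
  define \<epsilon> where "\<epsilon> = min 1 (\<delta> / (4 * M))"
  have M: "0 < M" using L C by (simp add: M_def)
  have K: "0 < K" using M \<delta> by (simp add: K_def)
  have \<epsilon>: "0 < \<epsilon>" "\<epsilon> \<le> 1" "M * \<epsilon> \<le> \<delta> / 4"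
    using M \<delta>(1) by (auto simp: \<epsilon>_def min_def field_simps)
  have step: "norm y = 1 \<and> \<not> eigenvector A y \<and> cdot v y \<noteq> 0 \<and>
      tangent v y \<le> K * tangent v x ^ Suc q \<and> tangent v y \<le> tangent v x / 2"
    if x: "norm x = 1" "\<not> eigenvector A x" "cdot v x \<noteq> 0" "tangent v x \<le> \<epsilon>"
      and g: "0 < g x" and z: "prqi_matrix A (g x) x *v z = x" and y: "y = z /\<^sub>R norm z" for x y z
  proof -
    \<comment> \<open>Chosen so that \<open>A - mat (l - \<sigma>)\<close> is exactly
      \<open>prqi_matrix A (g x) x\<close>.\<close>
    define \<sigma> where "\<sigma> = l - rayleigh A x + \<i> * of_real (g x)"
    let ?w = "norm (perp v x)" and ?t = "tangent v x"
    have z': "(A - mat (l - \<sigma>)) *v z = x"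
      using z by (simp add: prqi_matrix_def \<sigma>_def algebra_simps)
    have "cmod \<sigma> \<le> cmod (rayleigh A x - l) + g x"
      using norm_triangle_ineq [of "l - rayleigh A x" "\<i> * of_real (g x)"] g
      by (simp add: \<sigma>_def norm_mult norm_minus_commute)
    also have "\<dots> \<le> L * ?w\<^sup>2 + C * ?w ^ q"
      by (intro add_mono rayleigh_eigenvalue_bound A l v x L C)
    also have "\<dots> \<le> L * ?w ^ q + C * ?w ^ q"
      using q L norm_perp_le_one [OF v(2) x(1)]
      by (intro add_right_mono mult_left_mono power_decreasing) auto
    also have "\<dots> = M * ?w ^ q" by (simp add: M_def algebra_simps)
    also have "\<dots> \<le> M * ?t ^ q"
      using M by (intro mult_left_mono power_mono norm_perp_le_tangent v x) auto
    finally have \<sigma>: "cmod \<sigma> \<le> M * ?t ^ q" .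
    have "?t ^ q \<le> ?t ^ 1"
      using x \<epsilon> q by (intro power_decreasing tangent_nonneg) auto
    then have "M * ?t ^ q \<le> M * \<epsilon>"
      using x M by (intro mult_left_mono) auto
    then have \<sigma>4: "cmod \<sigma> \<le> \<delta> / 4" using \<sigma> \<epsilon> by linarith
    then have \<sigma>2: "cmod \<sigma> \<le> \<delta> / 2" using \<delta>(1) by linarith
    have zt: "cdot v z \<noteq> 0" "tangent v z \<le> 2 / \<delta> * cmod \<sigma> * ?t"
      using tangent_step [OF A l v \<delta> x(3) z' \<sigma>2] by auto
    have "2 / \<delta> * cmod \<sigma> \<le> 2 / \<delta> * (M * ?t ^ q)" "2 / \<delta> * cmod \<sigma> \<le> 2 / \<delta> * (\<delta> / 4)"
      using \<sigma> \<sigma>4 \<delta>(1) by (auto intro!: divide_right_mono)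
    then have "2 / \<delta> * cmod \<sigma> \<le> K * ?t ^ q" "2 / \<delta> * cmod \<sigma> \<le> 1 / 2"
      using \<delta>(1) by (auto simp: K_def)
    then have "2 / \<delta> * cmod \<sigma> * ?t \<le> K * ?t ^ q * ?t" "2 / \<delta> * cmod \<sigma> * ?t \<le> 1 / 2 * ?t"
      by (auto intro!: mult_right_mono tangent_nonneg simp del: times_divide_eq_left)
    with zt(2) have "tangent v z \<le> K * ?t ^ q * ?t" "tangent v z \<le> 1 / 2 * ?t"
      by (blast intro: order_trans)+
    then have bounds: "tangent v z \<le> K * ?t ^ Suc q" "tangent v z \<le> ?t / 2"
      by (simp_all add: mult_ac)
    have "z \<noteq> 0" using zt(1) by (auto simp: cdot_def)
    then have "norm y = 1" "tangent v y = tangent v z" "cdot v y \<noteq> 0"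
      using zt(1) by (auto simp: y tangent_scaleR cdot_scaleR_right)
    moreover have "\<not> eigenvector A y"
    proof
      assume "eigenvector A y"
      then have "eigenvector A z" unfolding y by (rule eigenvector_scaleR)
      then show False
        using eigenvector_of_shifted_solution [OF _ z'] x by fastforce
    qed
    ultimately show ?thesis using bounds by auto
  qed
  show ?thesis
    unfolding prqi_locally_convergent_def
  proof (intro exI conjI allI impI)
    fix \<gamma> :: "nat \<Rightarrow> real" and x
    assume prqi: "prqi A \<gamma> x" and \<gamma>: "\<forall>k. \<gamma> k = g (x k)"
      and ev: "\<not> eigenvector A (x 0)" and near: "tan_ext (angle (x 0) v) \<le> ereal \<epsilon>"
    have x0: "norm (x 0) = 1" using prqi by (simp add: prqi_def)
    \<comment> \<open>The geometric bound both keeps the iterates within \<epsilon> and forces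
      convergence; the other conjuncts ensure that the next step is taken and that
      \<open>tangent\<close> is the true tangent.\<close>
    define inv where "inv k \<longleftrightarrow> norm (x k) = 1 \<and> \<not> eigenvector A (x k) \<and> cdot v (x k) \<noteq> 0 \<and>
      tangent v (x k) \<le> \<epsilon> * (1 / 2) ^ k" for k
    have succ: "inv (Suc k) \<and> tangent v (x (Suc k)) \<le> K * tangent v (x k) ^ Suc q" if "inv k" for k
    proof -
      have "x k \<noteq> 0" using that by (auto simp: inv_def)
      then have "residual A (x k) \<noteq> 0"
        using that residual_zero_imp_eigenvector [of A "x k"] by (auto simp: inv_def)
      then obtain z where z: "0 < g (x k)" "prqi_matrix A (g (x k)) (x k) *v z = x k"
          "x (Suc k) = z /\<^sub>R norm z"
        using prqi \<gamma> by (auto simp: prqi_def)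
      have "\<epsilon> * (1 / 2) ^ k \<le> \<epsilon>"
        using \<epsilon> by (simp add: mult_left_le power_le_one)
      then have "tangent v (x k) \<le> \<epsilon>" using that by (simp add: inv_def)
      then show ?thesis
        using step [OF _ _ _ _ z] that by (auto simp: inv_def)
    qed
    \<comment> \<open>The finite bound \<open>near\<close> excludes \<open>cdot v (x 0) = 0\<close>,
      where \<open>tan_ext\<close> would be infinite.\<close>
    have "inv 0"
      using near ev x0 by (simp add: inv_def tan_ext_angle [OF v(2) x0] split: if_splits)
    then have inv: "inv k" for k
      by (induction k) (use succ in auto)
    then have tan: "tan_ext (angle (x k) v) = ereal (tangent v (x k))" for k
      by (simp add: tan_ext_angle v(2) inv_def)
    show "tan_ext (angle (x (Suc k)) v) \<le> ereal K * tan_ext (angle (x k) v) ^ Suc q" for k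
      using succ [OF inv, of k] by (simp add: tan del: power_Suc)
    have "(\<lambda>k. \<epsilon> * (1 / 2) ^ k) \<longlonglongrightarrow> \<epsilon> * 0"
      by (intro tendsto_mult tendsto_const LIMSEQ_power_zero) simp
    then have lim: "(\<lambda>k. \<epsilon> * (1 / 2) ^ k) \<longlonglongrightarrow> 0" by simp
    have "(\<lambda>k. tangent v (x k)) \<longlonglongrightarrow> 0"
    proof (rule tendsto_sandwich [OF _ _ tendsto_const lim])
      show "\<forall>\<^sub>F k in sequentially. 0 \<le> tangent v (x k)"
        by (simp add: tangent_nonneg)
      show "\<forall>\<^sub>F k in sequentially. tangent v (x k) \<le> \<epsilon> * (1 / 2) ^ k"
        using inv by (intro always_eventually allI) (simp only: inv_def)
    qed
    then show "(\<lambda>k. tan_ext (angle (x k) v)) \<longlonglongrightarrow> 0"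
      by (simp add: tan zero_ereal_def)
  qed (use \<epsilon> K in auto)
qed

theorem corollary3p4:
  fixes A :: "complex ^ 'n ^ 'n" and l\<^sub>1 :: complex and v\<^sub>1 :: "complex ^ 'n"
  assumes "hermitian A"
    and "eigenpair A l\<^sub>1 v\<^sub>1" and "norm v\<^sub>1 = 1"
    and "simple_eigenvalue A l\<^sub>1"
  shows "prqi_locally_convergent A (\<lambda>x. norm (residual A x)) 2 v\<^sub>1 \<and>
         prqi_locally_convergent A (\<lambda>x. (norm (residual A x))\<^sup>2) 3 v\<^sub>1"
proof -
  have l: "l\<^sub>1 \<in> \<real>" using assms hermitian_eigenvalue_real by blast
  have v: "A *v v\<^sub>1 = l\<^sub>1 *s v\<^sub>1" using assms by (simp add: eigenpair_def)
  obtain \<delta> where \<delta>: "0 < \<delta>" "\<And>w. cdot v\<^sub>1 w = 0 \<Longrightarrow> \<delta> * norm w \<le> norm ((A - mat l\<^sub>1) *v w)"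
    using simple_eigenvalue_gap [OF assms(1,2,4)] by auto
  obtain L where L: "0 < L" "\<And>y. norm ((A - mat l\<^sub>1) *v y) \<le> L * norm y"
    using bounded_linear.pos_bounded [OF matrix_vector_mul_bounded_linear, of "A - mat l\<^sub>1"]
    by (auto simp: mult.commute)
  \<comment> \<open>The residual has order 1 in the orthogonal component and its square order 2,
    which supplies \<open>q = 1\<close> and \<open>q = 2\<close>.\<close>
  have r: "norm (residual A x) \<le> 2 * L * norm (perp v\<^sub>1 x)" if "norm x = 1" for x
    using residual_bound [OF assms(1) l v assms(3) that _ L(2)] L(1) by simp
  have r2: "(norm (residual A x))\<^sup>2 \<le> (2 * L)\<^sup>2 * norm (perp v\<^sub>1 x) ^ 2" if "norm x = 1" for x
    using power_mono [OF r [OF that], of 2] by (simp add: power_mult_distrib)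
  have "prqi_locally_convergent A (\<lambda>x. norm (residual A x)) (Suc 1) v\<^sub>1"
    using r L by (intro prqi_locally_convergentI [OF assms(1) l v assms(3) \<delta> L, where C = "2 * L"]) auto
  moreover have "prqi_locally_convergent A (\<lambda>x. (norm (residual A x))\<^sup>2) (Suc 2) v\<^sub>1"
    using r2 by (intro prqi_locally_convergentI [OF assms(1) l v assms(3) \<delta> L, where C = "(2 * L)\<^sup>2"]) auto
  ultimately show ?thesis by (simp add: eval_nat_numeral)
qed

end
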